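(* Let $d,N\in\mathbb{N}$ with $N\ge 1$, let $\rho\in(0,2]$, $\mathfrak{s}=(\rho,1,1,\ldots,1)$, let $f$ be a polynomial of degree $N$, and let $\xi$ be space-time white noise. The fractional Allen--Cahn equation $\partial_tu=\Delta^{\rho/2}u+f(u)+\xi$ is locally subcritical if and only if $$\rho>\rho_c(N,d):=d\,\frac{N-1}{N+1}.$$
   Context: The equation is considered for $(t,x)\in[0,\infty)\times\mathbb{T}^d$, and $\Delta^{\rho/2}:=-(-\Delta)^{\rho/2}$ is the fractional Laplacian. Local subcriticality is defined algebraically. For the scaling $\mathfrak{s}$, space-time white noise has Hölder regularity just below $\alpha=-\frac{\rho+d}{2}$; put $\alpha_0=\alpha-\kappa$, where $\kappa>0$ is a fixed arbitrarily small constant (sufficiently small depending on $\rho,d,N$). Replace the right-hand side by the formal expression $F(U,\Xi)=f(U)+\Xi$; assign to $\Xi$ the homogeneity $\alpha_0$, to $U$ the homogeneity $\alpha_0+\rho$, and to $U^j$ the homogeneity $j(\alpha_0+\rho)$. The equation is called locally subcritical if all terms $U^j$ appearing in $f(U)$ have homogeneity strictly greater than $\alpha_0$. *)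

theory Defs
  imports Complex_Main "HOL-Computational_Algebra.Polynomial"
begin

text \<open>
  Local subcriticality of the fractional Allen--Cahn equation
  \<open>\<partial>\<^sub>t u = \<Delta>\<^bsup>\<rho>/2\<^esup> u + f(u) + \<xi>\<close> on \<open>[0,\<infinity>) \<times> T\<^sup>d\<close>, driven by space-time white noise \<open>\<xi>\<close>.
  It is a property of the formal right-hand side \<open>F(U,\<Xi>) = f(U) + \<Xi>\<close>: the equation
  enters through \<open>d\<close>, \<open>\<rho>\<close> and \<open>f\<close>, and \<open>\<xi>\<close> through the homogeneity given to \<open>\<Xi>\<close>.
\<close>

text \<open>The scaling \<open>(\<rho>, 1, \<dots>, 1)\<close>: time first, then the \<open>d\<close> space directions.\<close>

definition scaling :: "nat \<Rightarrow> real \<Rightarrow> real list" where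
  "scaling d \<rho> = \<rho> # replicate d 1"

text \<open>
  With respect to a scaling \<open>s\<close>, space-time white noise has Hoelder regularity just below
  \<open>-(s\<^sub>0 + \<dots> + s\<^sub>d)/2\<close>; here this is \<open>\<alpha> = -(\<rho> + d)/2\<close>.
\<close>

definition white_noise_exponent :: "real list \<Rightarrow> real" where
  "white_noise_exponent s = - sum_list s / 2"

text \<open>The small loss \<open>\<kappa> > 0\<close> gives \<open>\<alpha>\<^sub>0 = \<alpha> - \<kappa>\<close>.\<close>

definition alpha0 :: "nat \<Rightarrow> real \<Rightarrow> real \<Rightarrow> real" where
  "alpha0 d \<rho> \<kappa> = white_noise_exponent (scaling d \<rho>) - \<kappa>"

text \<open>\<open>Upow j\<close> stands for \<open>U\<^sup>j\<close>, so that \<open>U\<close> is \<open>Upow 1\<close> and \<open>Upow 0\<close> is the constant symbol.\<close>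

datatype symb = Xi | Upow nat

fun homogeneity :: "nat \<Rightarrow> real \<Rightarrow> real \<Rightarrow> symb \<Rightarrow> real" where
  "homogeneity d \<rho> \<kappa> Xi = alpha0 d \<rho> \<kappa>"
| "homogeneity d \<rho> \<kappa> (Upow j) = real j * (alpha0 d \<rho> \<kappa> + \<rho>)"

text \<open>\<open>F(U,\<Xi>) = f(U) + \<Xi>\<close> as a formal linear combination, given by its coefficients.\<close>

fun formal_rhs :: "real poly \<Rightarrow> symb \<Rightarrow> real" where
  "formal_rhs f Xi = 1"
| "formal_rhs f (Upow j) = coeff f j"

definition locally_subcritical :: "nat \<Rightarrow> real \<Rightarrow> real poly \<Rightarrow> real \<Rightarrow> bool" where
  "locally_subcritical d \<rho> f \<kappa> \<longleftrightarrow>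
     (\<forall>j. formal_rhs f (Upow j) \<noteq> 0 \<longrightarrow>
          homogeneity d \<rho> \<kappa> (Upow j) > homogeneity d \<rho> \<kappa> Xi)"

definition rho_c :: "nat \<Rightarrow> nat \<Rightarrow> real" where
  "rho_c N d = real d * ((real N - 1) / (real N + 1))"

end

theory Submission imports Defs
begin

text \<open>
  The homogeneity of \<open>U\<^sup>j\<close> is linear in \<open>j\<close> and exceeds \<open>\<alpha>\<^sub>0 < 0\<close> at \<open>j = 0\<close>, so only the leading
  power \<open>U\<^sup>N\<close> matters. For it the condition reads \<open>(N + 1) \<rho> - (N - 1) d > 2 (N - 1) \<kappa>\<close>, which for
  small \<open>\<kappa>\<close> is equivalent to the positivity of the left-hand side.
\<close>

lemma alpha0_eq: "alpha0 d \<rho> \<kappa> = - (\<rho> + real d) / 2 - \<kappa>"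
  by (simp add: alpha0_def white_noise_exponent_def scaling_def sum_list_replicate)

lemma rho_c_less_iff: "rho_c N d < \<rho> \<longleftrightarrow> 0 < (real N + 1) * \<rho> - (real N - 1) * real d"
proof -
  have "rho_c N d = ((real N - 1) * real d) / (real N + 1)"
    by (simp add: rho_c_def)
  moreover have "0 < real N + 1"
    by simp
  ultimately show ?thesis
    by (simp add: pos_divide_less_eq mult.commute)
qed

lemma locally_subcritical_iff_leading:
  assumes "alpha0 d \<rho> \<kappa> < 0" and "f \<noteq> 0"
  shows "locally_subcritical d \<rho> f \<kappa> \<longleftrightarrow>
           alpha0 d \<rho> \<kappa> < real (degree f) * (alpha0 d \<rho> \<kappa> + \<rho>)"
proof
  assume "locally_subcritical d \<rho> f \<kappa>"
  then show "alpha0 d \<rho> \<kappa> < real (degree f) * (alpha0 d \<rho> \<kappa> + \<rho>)"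
    using \<open>f \<noteq> 0\<close> by (simp add: locally_subcritical_def)
next
  let ?a = "alpha0 d \<rho> \<kappa>"
  assume lead: "?a < real (degree f) * (?a + \<rho>)"
  have "?a < real j * (?a + \<rho>)" if "coeff f j \<noteq> 0" for j
  proof (cases "?a + \<rho> \<ge> 0")
    case True
    then have "0 \<le> real j * (?a + \<rho>)"
      by simp
    with assms(1) show ?thesis
      by linarith
  next
    case False
    then have "real (degree f) * (?a + \<rho>) \<le> real j * (?a + \<rho>)"
      using le_degree[OF that] by (intro mult_right_mono_neg) auto
    with lead show ?thesis
      by linarith
  qed
  then show "locally_subcritical d \<rho> f \<kappa>"
    by (simp add: locally_subcritical_def)
qed

theorem theorem4p3:
  fixes d N :: nat and \<rho> :: real
  assumes "N \<ge> 1" and "0 < \<rho>" and "\<rho> \<le> 2"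
  shows "\<exists>\<kappa>\<^sub>0>0. \<forall>\<kappa>. 0 < \<kappa> \<and> \<kappa> < \<kappa>\<^sub>0 \<longrightarrow>
           (\<forall>f :: real poly. degree f = N \<longrightarrow>
              (locally_subcritical d \<rho> f \<kappa> \<longleftrightarrow> \<rho> > rho_c N d))"
proof -
  define gap where "gap = (real N + 1) * \<rho> - (real N - 1) * real d"
  \<comment> \<open>This bound depends on \<open>N\<close>, \<open>d\<close> and \<rho> only, so it
    serves all \<open>f\<close> at once. For positive \<open>gap\<close> it gives
    \<open>2 * N * \<kappa> < gap\<close>; dividing by \<open>2 * N\<close> instead of
    \<open>2 * (N - 1)\<close> also covers \<open>N = 1\<close>. For \<open>gap \<le> 0\<close> both
    sides of the equivalence fail for every positive \<kappa>, so the value 1 is arbitrary.\<close>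
  define \<kappa>\<^sub>0 where "\<kappa>\<^sub>0 = (if 0 < gap then gap / (2 * real N) else 1)"
  have "0 < \<kappa>\<^sub>0"
    using assms(1) by (simp add: \<kappa>\<^sub>0_def)
  moreover have "locally_subcritical d \<rho> f \<kappa> \<longleftrightarrow> rho_c N d < \<rho>"
    if \<kappa>: "0 < \<kappa>" "\<kappa> < \<kappa>\<^sub>0" and f: "degree f = N" for \<kappa> and f :: "real poly"
  proof -
    have "alpha0 d \<rho> \<kappa> < 0"
      using \<kappa>(1) assms(2) by (simp add: alpha0_eq field_simps add_pos_nonneg)
    \<comment> \<open>The zero polynomial has degree 0 by convention, which \<open>N \<ge> 1\<close>
      excludes.\<close>
    moreover have "f \<noteq> 0"
      using f assms(1) by auto
    ultimately have "locally_subcritical d \<rho> f \<kappa> \<longleftrightarrow>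
        alpha0 d \<rho> \<kappa> < real N * (alpha0 d \<rho> \<kappa> + \<rho>)"
      by (simp add: locally_subcritical_iff_leading f)
    also have "\<dots> \<longleftrightarrow> 2 * (real N - 1) * \<kappa> < gap"
    proof -
      have "real N * (alpha0 d \<rho> \<kappa> + \<rho>) - alpha0 d \<rho> \<kappa> = (gap - 2 * (real N - 1) * \<kappa>) / 2"
        by (simp add: alpha0_eq gap_def field_simps)
      then show ?thesis
        by (metis diff_gt_0_iff_gt half_gt_zero_iff)
    qed
    also have "\<dots> \<longleftrightarrow> 0 < gap"
    proof
      have "0 \<le> 2 * (real N - 1) * \<kappa>"
        using \<kappa>(1) assms(1) by simp
      then show "0 < gap" if "2 * (real N - 1) * \<kappa> < gap"
        using that by linarith
    next
      assume "0 < gap"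
      \<comment> \<open>This is stronger than the goal by the positive amount
        \<open>2 * \<kappa>\<close>.\<close>
      then have "2 * real N * \<kappa> < gap"
        using \<kappa>(2) assms(1) by (simp add: \<kappa>\<^sub>0_def field_simps)
      then show "2 * (real N - 1) * \<kappa> < gap"
        using \<kappa>(1) by (simp add: algebra_simps)
    qed
    also have "\<dots> \<longleftrightarrow> rho_c N d < \<rho>"
      by (simp add: rho_c_less_iff gap_def)
    finally show ?thesis .
  qed
  ultimately show ?thesis
    by blast
qed

end
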